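(* Let $A=(a_{j,k})$ be an $n\times\infty$ matrix, where $1\le j\le n$ and $1\le k<\infty$. Then $\mathcal R_A^{\gamma,\lambda}\neq\emptyset$ for some pair $(\gamma,\lambda)$ with $0\le\gamma\le\lambda\le n$.
   Context: For an $n\times\infty$ matrix $A=(a_{j,k})$, an $n\times\infty$ matrix $B=(b_{j,k})$ is said to be obtained from $A$ by row rearrangements if there is a one-to-one mapping $\sigma$ from $\{1,2,\dots,n\}$ onto itself with $b_{j,k}=a_{\sigma(j),k}$ for all $j$ and all $k$; $\mathcal R_A$ denotes the collection of these matrices. For integers $0\le\gamma\le\lambda\le n$, $\mathcal R_A^{\gamma,\lambda}$ is the set of all $B=(b_{j,k})\in\mathcal R_A$ of the following form (row indices lie in $\{1,\dots,n\}$ and the inequalities are understood for all $k\ge1$): (i) $b_{j,k}\ge b_{j+1,k}$ for $j\le\gamma$ or $j\ge\lambda$; (ii) $b_{r_1,k}\ge b_{j,k}\ge b_{r_2,k}$ for $r_1\le\gamma<j<\lambda\le r_2$; (iii) no $\alpha$ with $\gamma<\alpha<\lambda$ possesses the property: $b_{\alpha,k}\ge b_{j,k}$ for all $\gamma<j<\lambda$, or $b_{\alpha,k}\le b_{j,k}$ for all $\gamma<j<\lambda$.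
   Formalization: The range of the pair is 0 ≤ γ ≤ λ ≤ n+1 instead of λ ≤ n, so that the bottom block may be empty; with λ ≤ n the claim fails for n = 2 and the incomparable rows (1,0,0,…), (0,1,0,…). *)

theory Defs
  imports Complex_Main
begin

(* An n x \<infinity> real matrix is a function A :: nat \<Rightarrow> nat \<Rightarrow> real of which only the entries
   A j k with 1 \<le> j \<le> n and 1 \<le> k are significant. *)

definition row_rearrangements :: "nat \<Rightarrow> (nat \<Rightarrow> nat \<Rightarrow> real) \<Rightarrow> (nat \<Rightarrow> nat \<Rightarrow> real) set" where
  "row_rearrangements n A =
     {B. \<exists>\<sigma>. bij_betw \<sigma> {1..n} {1..n} \<and> (\<forall>j\<in>{1..n}. \<forall>k\<ge>1. B j k = A (\<sigma> j) k)}"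

definition row_ge :: "(nat \<Rightarrow> nat \<Rightarrow> real) \<Rightarrow> nat \<Rightarrow> nat \<Rightarrow> bool" where
  "row_ge B i j \<longleftrightarrow> (\<forall>k\<ge>1. B i k \<ge> B j k)"

(* The two halves of the chain  b_{r1} \<ge> b_j \<ge> b_{r2}  are separate conditions: the second one
   is required also when gam = 0 (so that no r1 exists), and the first one also when no r2 \<ge> lam
   is a row index. *)

definition row_rearrangements_split ::
    "nat \<Rightarrow> (nat \<Rightarrow> nat \<Rightarrow> real) \<Rightarrow> nat \<Rightarrow> nat \<Rightarrow> (nat \<Rightarrow> nat \<Rightarrow> real) set" where
  "row_rearrangements_split n A gam lam =
     {B \<in> row_rearrangements n A.
        (\<forall>j. 1 \<le> j \<and> j + 1 \<le> n \<and> (j \<le> gam \<or> j \<ge> lam) \<longrightarrow> row_ge B j (j + 1)) \<and>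
        (\<forall>j. gam < j \<and> j < lam \<longrightarrow>
             (\<forall>r1\<in>{1..n}. r1 \<le> gam \<longrightarrow> row_ge B r1 j) \<and>
             (\<forall>r2\<in>{1..n}. lam \<le> r2 \<longrightarrow> row_ge B j r2)) \<and>
        \<not> (\<exists>\<alpha>. gam < \<alpha> \<and> \<alpha> < lam \<and>
             ((\<forall>j. gam < j \<and> j < lam \<longrightarrow> row_ge B \<alpha> j) \<or>
              (\<forall>j. gam < j \<and> j < lam \<longrightarrow> row_ge B j \<alpha>)))}"

(* The bottom block consists of the rows j with lam \<le> j \<le> n, so it is empty exactly for
   lam = n + 1.  The source states the range as lam \<le> n, which forces row n to lie below all the
   others; for the 2 x \<infinity> matrix with incomparable rows (1,0,0,...) and (0,1,0,...) the set is then
   empty for every pair (gam, lam), so lam = n + 1 has to be admitted. *)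

lemma split_le_n_counterexample:
  fixes gam lam :: nat
  assumes "gam \<le> lam" "lam \<le> 2"
  shows "row_rearrangements_split 2 (\<lambda>j k. if j = k then 1 else 0) gam lam = {}"
proof (rule ccontr)
  let ?A = "\<lambda>j k :: nat. if j = k then 1 else (0::real)"
  assume "row_rearrangements_split 2 ?A gam lam \<noteq> {}"
  then obtain B where B: "B \<in> row_rearrangements_split 2 ?A gam lam" by blast
  then obtain \<sigma> where bij: "bij_betw \<sigma> {1..2} {1..2::nat}"
    and eq: "\<forall>j\<in>{1..2}. \<forall>k\<ge>1. B j k = ?A (\<sigma> j) k"
    unfolding row_rearrangements_split_def row_rearrangements_def by blast
  have dom: "\<sigma> 2 \<ge> 1"
    using bij_betwE[OF bij] by simp
  have ne: "\<sigma> 1 \<noteq> \<sigma> 2"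
    using inj_onD[OF bij_betw_imp_inj_on[OF bij], of 1 2] by force
  have "B 1 (\<sigma> 2) = 0" "B 2 (\<sigma> 2) = 1"
    using eq dom ne by simp_all
  then have not_ge: "\<not> row_ge B 1 2"
    using dom unfolding row_ge_def by (metis not_one_le_zero)
  have chain: "\<forall>j. 1 \<le> j \<and> j + 1 \<le> 2 \<and> (j \<le> gam \<or> j \<ge> lam) \<longrightarrow> row_ge B j (j + 1)"
    and mid: "\<not> (\<exists>\<alpha>. gam < \<alpha> \<and> \<alpha> < lam \<and>
             ((\<forall>j. gam < j \<and> j < lam \<longrightarrow> row_ge B \<alpha> j) \<or>
              (\<forall>j. gam < j \<and> j < lam \<longrightarrow> row_ge B j \<alpha>)))"
    using B unfolding row_rearrangements_split_def mem_Collect_eq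
    by - (elim conjE, assumption)+
  have "\<not> 1 \<le> gam" "\<not> 1 \<ge> lam"
    using chain[rule_format, of 1] not_ge by (auto simp: numeral_2_eq_2)
  then have gl: "gam = 0" "lam = 2" using assms by auto
  have "\<forall>j. gam < j \<and> j < lam \<longrightarrow> row_ge B 1 j"
  proof (intro allI impI)
    fix j assume "gam < j \<and> j < lam"
    then have "j = 1" using gl by auto
    then show "row_ge B 1 j" by (simp add: row_ge_def)
  qed
  moreover have "gam < 1" "1 < lam" using gl by auto
  ultimately show False using mid by blast
qed

end

theory Submission
  imports Defs "HOL-Combinatorics.Transposition"
begin

text \<open>Peel rows off the unsorted middle block: as long as some middle row dominates all the
  others, or is dominated by all of them, swap it to the upper or lower end of the block and shrink
  the block by one. When this stops, possibly at an empty block, condition (iii) holds.\<close>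

text \<open>Comparing all pairs rather than neighbours merges conditions (i) and (ii) into one.\<close>

definition sorted_outside :: "nat \<Rightarrow> (nat \<Rightarrow> nat \<Rightarrow> real) \<Rightarrow> nat \<Rightarrow> nat \<Rightarrow> bool" where
  "sorted_outside n B gam lam \<longleftrightarrow>
     (\<forall>i j. 1 \<le> i \<and> i < j \<and> j \<le> n \<and> (i \<le> gam \<or> lam \<le> j) \<longrightarrow> row_ge B i j)"

lemma sorted_outsideD:
  assumes "sorted_outside n B gam lam" "1 \<le> i" "i < j" "j \<le> n" "i \<le> gam \<or> lam \<le> j"
  shows "row_ge B i j"
  using assms unfolding sorted_outside_def by blast

lemma row_ge_comp: "row_ge (B \<circ> \<tau>) i j \<longleftrightarrow> row_ge B (\<tau> i) (\<tau> j)"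
  by (simp add: row_ge_def)

lemma row_rearrangements_refl: "A \<in> row_rearrangements n A"
  unfolding row_rearrangements_def using bij_betw_id by (auto intro!: exI[of _ id])

lemma row_rearrangements_comp:
  assumes "B \<in> row_rearrangements n A" and \<tau>: "bij_betw \<tau> {1..n} {1..n}"
  shows "B \<circ> \<tau> \<in> row_rearrangements n A"
proof -
  obtain \<sigma> where \<sigma>: "bij_betw \<sigma> {1..n} {1..n}"
    and eq: "\<forall>j\<in>{1..n}. \<forall>k\<ge>1. B j k = A (\<sigma> j) k"
    using assms(1) unfolding row_rearrangements_def by blast
  have "\<forall>j\<in>{1..n}. \<forall>k\<ge>1. (B \<circ> \<tau>) j k = A ((\<sigma> \<circ> \<tau>) j) k"
    using eq bij_betwE[OF \<tau>] by simp
  with bij_betw_trans[OF \<tau> \<sigma>] show ?thesis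
    unfolding row_rearrangements_def by blast
qed

lemma row_rearrangements_transpose:
  assumes "B \<in> row_rearrangements n A" "a \<in> {1..n}" "b \<in> {1..n}"
  shows "B \<circ> transpose a b \<in> row_rearrangements n A"
  using assms by (intro row_rearrangements_comp) auto

text \<open>Both swapped positions lie strictly between \<open>gam\<close> and \<open>lam\<close>,
  so comparisons with rows outside the block survive; the only new ones are between position
  \<open>gam + 1\<close> and the rest of the block, and there \<open>top\<close> applies.\<close>

lemma sorted_outside_raise_top:
  assumes B: "sorted_outside n B gam lam" and \<alpha>: "gam < \<alpha>" "\<alpha> < lam"
    and top: "\<And>j. gam < j \<Longrightarrow> j < lam \<Longrightarrow> row_ge B \<alpha> j"
    and "lam \<le> n + 1"
  shows "sorted_outside n (B \<circ> transpose \<alpha> (gam + 1)) (gam + 1) lam"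
  unfolding sorted_outside_def row_ge_comp
proof (intro allI impI)
  let ?\<tau> = "transpose \<alpha> (gam + 1)"
  fix i j assume ij: "1 \<le> i \<and> i < j \<and> j \<le> n \<and> (i \<le> gam + 1 \<or> lam \<le> j)"
  show "row_ge B (?\<tau> i) (?\<tau> j)"
  proof (cases "i = gam + 1 \<and> j < lam")
    case True
    then show ?thesis using ij \<alpha> by (auto simp: transpose_def intro!: top)
  next
    \<comment> \<open>Here \<open>i \<le> gam\<close> or \<open>lam \<le> j\<close>. The swap fixes
      every index outside the block and keeps the others inside it, so the images stay in order and
      in range and the old sortedness applies.\<close>
    case False
    show ?thesis
      by (rule sorted_outsideD[OF B]) (use False ij \<alpha> \<open>lam \<le> n + 1\<close> in \<open>auto simp: transpose_def\<close>)
  qed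
qed

text \<open>Mirror image of the previous lemma: the dominated row goes to the last block position,
  \<open>lam\<close>. Starting from \<open>lam + 1\<close> avoids truncated subtraction.\<close>

lemma sorted_outside_lower_bottom:
  assumes B: "sorted_outside n B gam (lam + 1)" and \<alpha>: "gam < \<alpha>" "\<alpha> \<le> lam"
    and bot: "\<And>j. gam < j \<Longrightarrow> j \<le> lam \<Longrightarrow> row_ge B j \<alpha>"
    and "lam \<le> n"
  shows "sorted_outside n (B \<circ> transpose \<alpha> lam) gam lam"
  unfolding sorted_outside_def row_ge_comp
proof (intro allI impI)
  let ?\<tau> = "transpose \<alpha> lam"
  fix i j assume ij: "1 \<le> i \<and> i < j \<and> j \<le> n \<and> (i \<le> gam \<or> lam \<le> j)"
  show "row_ge B (?\<tau> i) (?\<tau> j)"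
  proof (cases "gam < i \<and> j = lam")
    case True
    then show ?thesis using ij \<alpha> by (auto simp: transpose_def intro!: bot)
  next
    case False
    show ?thesis
      by (rule sorted_outsideD[OF B]) (use False ij \<alpha> \<open>lam \<le> n\<close> in \<open>auto simp: transpose_def\<close>)
  qed
qed

text \<open>Induction on \<open>lam - gam\<close>, with \<open>B\<close> arbitrary because each step
  permutes its rows while \<open>A\<close> stays fixed. The block is empty when
  \<open>lam = gam + 1\<close>.\<close>

lemma split_nonempty_of_sorted_outside:
  assumes "B \<in> row_rearrangements n A" "sorted_outside n B gam lam" "gam < lam" "lam \<le> n + 1"
  shows "\<exists>gam' lam'. gam' < lam' \<and> lam' \<le> n + 1 \<and> row_rearrangements_split n A gam' lam' \<noteq> {}"
  using assms
proof (induction "lam - gam" arbitrary: B gam lam rule: less_induct)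
  case less
  note B = less.prems
  let ?top = "\<lambda>\<alpha>. \<forall>j. gam < j \<and> j < lam \<longrightarrow> row_ge B \<alpha> j"
  let ?bot = "\<lambda>\<alpha>. \<forall>j. gam < j \<and> j < lam \<longrightarrow> row_ge B j \<alpha>"
  show ?case
  proof (cases "\<exists>\<alpha>. gam < \<alpha> \<and> \<alpha> < lam \<and> (?top \<alpha> \<or> ?bot \<alpha>)")
    case False
    \<comment> \<open>Condition (iii) is the failed case assumption; (i) and (ii) are instances of
      \<open>sorted_outside\<close>, where for (i) \<open>j \<ge> lam\<close> gives
      \<open>lam \<le> j + 1\<close>.\<close>
    have "B \<in> row_rearrangements_split n A gam lam"
      unfolding row_rearrangements_split_def mem_Collect_eq
    proof (intro conjI)
      show "\<forall>j. gam < j \<and> j < lam \<longrightarrow>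
             (\<forall>r1\<in>{1..n}. r1 \<le> gam \<longrightarrow> row_ge B r1 j) \<and>
             (\<forall>r2\<in>{1..n}. lam \<le> r2 \<longrightarrow> row_ge B j r2)"
        using B(4) by (auto intro!: sorted_outsideD[OF B(2)])
    qed (use B(1) False in \<open>auto intro!: sorted_outsideD[OF B(2)]\<close>)
    then show ?thesis using B(3,4) by blast
  next
    case True
    then obtain \<alpha> where \<alpha>: "gam < \<alpha>" "\<alpha> < lam" and "?top \<alpha> \<or> ?bot \<alpha>" by blast
    from this(3) show ?thesis
    proof
      assume "?top \<alpha>"
      then have "sorted_outside n (B \<circ> transpose \<alpha> (gam + 1)) (gam + 1) lam"
        using B(2,4) \<alpha> by (intro sorted_outside_raise_top) auto
      moreover have "B \<circ> transpose \<alpha> (gam + 1) \<in> row_rearrangements n A"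
        using B(1,4) \<alpha> by (intro row_rearrangements_transpose) auto
      ultimately show ?thesis
        \<comment> \<open>The bounds \<open>gam < \<alpha> < lam\<close> give
          \<open>gam + 1 < lam\<close>, so the smaller block is admissible.\<close>
        using less.hyps[of lam "gam + 1"] B(4) \<alpha> by simp
    next
      assume bot: "?bot \<alpha>"
      obtain m where m: "lam = m + 1" using \<alpha> by (cases lam) auto
      have "sorted_outside n (B \<circ> transpose \<alpha> m) gam m"
        using B(2,4) \<alpha> bot m by (intro sorted_outside_lower_bottom) auto
      moreover have "B \<circ> transpose \<alpha> m \<in> row_rearrangements n A"
        using B(1,4) \<alpha> m by (intro row_rearrangements_transpose) auto
      ultimately show ?thesis
        using less.hyps[of m gam] B(4) \<alpha> m by simp
    qed
  qed
qed

theorem lemma2p2: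
  fixes n :: nat and A :: "nat \<Rightarrow> nat \<Rightarrow> real"
  shows "\<exists>gam lam. 0 \<le> gam \<and> gam \<le> lam \<and> lam \<le> n + 1 \<and> row_rearrangements_split n A gam lam \<noteq> {}"
proof -
  \<comment> \<open>Initially all rows form the block, so sortedness outside it is vacuous.\<close>
  have "sorted_outside n A 0 (n + 1)"
    by (auto simp: sorted_outside_def)
  from split_nonempty_of_sorted_outside[OF row_rearrangements_refl this]
  show ?thesis by (auto intro: less_imp_le)
qed

end
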